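(* Let $\alpha>0$ and $p\in[0,1]$. Consider the random graph $\mathrm{G_{Poi}}(\alpha,p)$, let $\rho$ be a given vertex of its stack, and let $K\geq 0$ be the number of neighbors of $\rho$ in the core. Then $K$ has the Poisson law $\mathcal{P}(\alpha p)$ and, conditionally on $K$, the graph obtained after removing $\rho$ and placing its $K$ neighbors in the stack (erasing all possible edges between vertices of the new stack) has law $\mathrm{G_{Poi}}(\alpha(1-p),p)$.
   Context: $\mathcal{P}(\alpha)$ denotes the Poisson law of expectation $\alpha$ (with $\mathcal{P}(0)$ the Dirac mass at $0$). $G(N,p)$ is the Erdős–Rényi random graph on $N$ vertices in which each of the $\binom{N}{2}$ edges is present independently with probability $p$. Definition of $\mathrm{G_{Poi}}(\alpha,p)$: let $N\sim\mathcal{P}(\alpha)$. Conditionally on $N$, the graph consists of a $G(N,p)$ random graph, called the core, together with a countably infinite collection of additional vertices, called the stack; each pair (stack vertex, core vertex) is joined by an edge independently with probability $p$, independently also of the edges of the core. There is no edge between vertices of the stack. Step of exploration: given a vertex $\rho$ of the stack, reveal its neighbors $y_1,\dots,y_K$ in the core; remove $\rho$; regard $y_1,\dots,y_K$ as vertices of the stack (no longer of the core); erase all possible edges between vertices of the new stack. The new core consists of the $N-K$ core vertices not adjacent to $\rho$, with the induced edges. Laws of graphs are understood after the obvious relabelling of vertices (e.g. core vertices relabelled in increasing order by $1,2,\dots$, and the new stack listed as $y_1,\dots,y_K$ in increasing order of their original labels followed by the remaining old stack vertices in their original order). *)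

theory Defs
  imports "HOL-Probability.Probability"
begin

(* The library's poisson_pmf is characterised for positive rates only. *)
definition poisson_law :: "real \<Rightarrow> nat pmf" where
  "poisson_law \<alpha> = (if \<alpha> = 0 then return_pmf 0 else poisson_pmf \<alpha>)"

datatype vertex = Core nat | Stack nat

(* (n, E) is the graph with core vertices Core 0, ..., Core (n - 1), stack vertices Stack 0,
   Stack 1, ..., and edge set E; an edge is an unordered pair {u, v}. *)
type_synonym graph = "nat \<times> vertex set set"

definition core_pairs :: "nat \<Rightarrow> vertex set set" where
  "core_pairs n = {{Core i, Core j} |i j. i < j \<and> j < n}"

definition stack_core_pairs :: "nat \<Rightarrow> vertex set set" where
  "stack_core_pairs n = {{Stack k, Core i} |k i. i < n}"

(* The smallest sigma-algebra making every event "u and v are joined" measurable. *)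
definition edge_space :: "vertex set set measure" where
  "edge_space = sigma UNIV {{E. {u, v} \<in> E} |u v. True}"

definition graph_space :: "graph measure" where
  "graph_space = count_space UNIV \<Otimes>\<^sub>M edge_space"

(* Each pair in A is retained independently with probability p; for A = core_pairs n this is
   the Erdos-Renyi graph G(n, p). *)
definition random_edges :: "real \<Rightarrow> vertex set set \<Rightarrow> vertex set set measure" where
  "random_edges p A =
     distr (Pi\<^sub>M A (\<lambda>_. measure_pmf (bernoulli_pmf p))) edge_space (\<lambda>\<omega>. {e \<in> A. \<omega> e})"

(* The law conditionally on the core having n vertices. *)
definition G_given_core :: "nat \<Rightarrow> real \<Rightarrow> graph measure" where
  "G_given_core n p =
     distr (random_edges p (core_pairs n \<union> stack_core_pairs n)) graph_space (Pair n)"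

definition G_Poi :: "real \<Rightarrow> real \<Rightarrow> graph measure" where
  "G_Poi \<alpha> p = measure_pmf (poisson_law \<alpha>) \<bind> (\<lambda>n. G_given_core n p)"

definition core_nbrs :: "nat \<Rightarrow> graph \<Rightarrow> nat set" where
  "core_nbrs r G = {i. i < fst G \<and> {Stack r, Core i} \<in> snd G}"

definition num_core_nbrs :: "nat \<Rightarrow> graph \<Rightarrow> nat" where
  "num_core_nbrs r G = card (core_nbrs r G)"

(* Relabelling: maps a vertex of the graph obtained by exploring Stack r to its label in G.
   The K neighbours of Stack r, in increasing order, head the new stack; the other stack vertices
   follow in their original order, the label r being skipped. *)
fun old_label :: "nat \<Rightarrow> graph \<Rightarrow> vertex \<Rightarrow> vertex" where
  "old_label r G (Core i) = Core (sorted_list_of_set ({..<fst G} - core_nbrs r G) ! i)"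
| "old_label r G (Stack j) =
     (let K = num_core_nbrs r G in
      if j < K then Core (sorted_list_of_set (core_nbrs r G) ! j)
      else if j - K < r then Stack (j - K)
      else Stack (Suc (j - K)))"

(* Edges between two vertices of the new stack are erased by keeping only core-core and
   stack-core pairs of new labels. *)
definition explore :: "nat \<Rightarrow> graph \<Rightarrow> graph" where
  "explore r G =
     (let m = fst G - num_core_nbrs r G in
      (m, {e \<in> core_pairs m \<union> stack_core_pairs m. old_label r G ` e \<in> snd G}))"

end

theory Submission
  imports Defs
begin

text \<open>
  Condition on the core size \<open>n\<close> and on the set \<open>S\<close> of the \<open>k\<close> neighbours of \<open>\<rho>\<close>. This conditioning
  only looks at the pairs joining \<open>\<rho>\<close> to the core, whereas the explored graph only looks at other
  pairs, each at most once since the relabelling is injective; hence the explored graph has the law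
  given a core of \<open>n - k\<close> vertices. Averaging over \<open>S\<close> and then over \<open>n\<close>, the identity
  \<open>P(\<alpha>){n} (n choose k) p\<^sup>k (1 - p)\<^sup>n\<^sup>-\<^sup>k = P(\<alpha>p){k} P(\<alpha>(1 - p)){n - k}\<close> makes \<open>K\<close> Poisson and
  independent of the explored graph. On the generating events \<open>cylinder m J\<close> only \<open>n = m + k\<close>
  contributes, so no series has to be summed.
\<close>

subsection \<open>Relabelling\<close>

definition pairs :: "nat \<Rightarrow> vertex set set" where
  "pairs n = core_pairs n \<union> stack_core_pairs n"

text \<open>With \<open>S = {..<n}\<close> these are exactly the pairs that exploring
  \<open>Stack r\<close> reveals.\<close>

definition star :: "nat \<Rightarrow> nat set \<Rightarrow> vertex set set" where
  "star r S = (\<lambda>i. {Stack r, Core i}) ` S"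

lemma core_pair_in_pairs: "{Core i, Core j} \<in> pairs n \<longleftrightarrow> i \<noteq> j \<and> i < n \<and> j < n"
proof
  assume "i \<noteq> j \<and> i < n \<and> j < n"
  then show "{Core i, Core j} \<in> pairs n"
  proof (cases "i < j")
    case False
    then have "j < i" using \<open>i \<noteq> j \<and> i < n \<and> j < n\<close> by simp
    then show ?thesis
      using \<open>i \<noteq> j \<and> i < n \<and> j < n\<close>
      by (auto simp: pairs_def core_pairs_def doubleton_eq_iff)
  qed (auto simp: pairs_def core_pairs_def)
qed (auto simp: pairs_def core_pairs_def stack_core_pairs_def doubleton_eq_iff)

lemma stack_core_pair_in_pairs: "{Stack k, Core i} \<in> pairs n \<longleftrightarrow> i < n"
  by (auto simp: pairs_def core_pairs_def stack_core_pairs_def doubleton_eq_iff)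

lemma pairs_cases:
  assumes "e \<in> pairs n"
  obtains (core) i j where "e = {Core i, Core j}" "i < j" "j < n"
  | (stack) k i where "e = {Stack k, Core i}" "i < n"
  using assms by (auto simp: pairs_def core_pairs_def stack_core_pairs_def)

lemma star_subset_pairs: "S \<subseteq> {..<n} \<Longrightarrow> star r S \<subseteq> pairs n"
  by (auto simp: star_def stack_core_pair_in_pairs)

lemma inj_star: "inj_on (\<lambda>i. {Stack r, Core i}) S"
  by (auto simp: inj_on_def doubleton_eq_iff)

lemma core_nbrs_subset: "core_nbrs r G \<subseteq> {..<fst G}"
  by (auto simp: core_nbrs_def)

lemma finite_core_nbrs: "finite (core_nbrs r G)"
  using core_nbrs_subset finite_lessThan by (rule finite_subset)

lemma card_core_nbrs_compl: "card ({..<fst G} - core_nbrs r G) = fst G - num_core_nbrs r G"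
  by (simp add: card_Diff_subset core_nbrs_subset finite_core_nbrs num_core_nbrs_def)

lemma explore_eq:
  "explore r G = (fst G - num_core_nbrs r G,
     {e \<in> pairs (fst G - num_core_nbrs r G). old_label r G ` e \<in> snd G})"
  by (simp add: explore_def pairs_def Let_def)

lemma old_label_Core_in:
  assumes "i < fst G - num_core_nbrs r G"
  obtains a where "old_label r G (Core i) = Core a" "a < fst G" "a \<notin> core_nbrs r G"
proof -
  have "sorted_list_of_set ({..<fst G} - core_nbrs r G) ! i
      \<in> set (sorted_list_of_set ({..<fst G} - core_nbrs r G))"
    using assms by (intro nth_mem) (simp add: card_core_nbrs_compl)
  then show ?thesis using that by simp
qed

lemma old_label_Stack_cases:
  obtains (core) a where "old_label r G (Stack j) = Core a" "a \<in> core_nbrs r G"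
  | (stack) b where "old_label r G (Stack j) = Stack b" "b \<noteq> r"
proof (cases "j < num_core_nbrs r G")
  case True
  then have "sorted_list_of_set (core_nbrs r G) ! j \<in> set (sorted_list_of_set (core_nbrs r G))"
    by (intro nth_mem) (simp add: num_core_nbrs_def)
  then show ?thesis using that(1) True finite_core_nbrs by (simp add: Let_def)
next
  case False
  then show ?thesis using that(2) by (cases "j - num_core_nbrs r G < r") (simp_all add: Let_def)
qed

text \<open>The domain is the vertex set of the explored graph; a larger \<open>Core\<close> index
  would run past the end of the list. New core vertices come from non-neighbours, new stack vertices
  from neighbours or from the old stack, so the two images are disjoint. Within each, the sorted
  lists have distinct entries and the shift past \<open>r\<close> is injective.\<close>

lemma inj_old_label:
  "inj_on (old_label r G) (Core ` {..<fst G - num_core_nbrs r G} \<union> range Stack)"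
proof -
  have "inj_on (old_label r G) (Core ` {..<fst G - num_core_nbrs r G})"
    by (auto simp: inj_on_def nth_eq_iff_index_eq card_core_nbrs_compl)
  moreover have "inj_on (old_label r G) (range Stack)"
    by (auto simp: inj_on_def Let_def num_core_nbrs_def nth_eq_iff_index_eq split: if_splits)
  moreover have "old_label r G (Core i) \<noteq> old_label r G (Stack j)"
    if "i < fst G - num_core_nbrs r G" for i j
    using that by (rule old_label_Core_in, cases rule: old_label_Stack_cases[of r G j]) auto
  ultimately show ?thesis
    by (subst inj_on_Un) (use vertex.exhaust in \<open>fastforce\<close>)
qed

lemma pairs_subset_Pow: "pairs m \<subseteq> Pow (Core ` {..<m} \<union> range Stack)"
  by (auto simp: pairs_def core_pairs_def stack_core_pairs_def)

text \<open>An injective map of vertices is injective on sets of vertices. Distinct pairs of the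
  explored graph are therefore read off distinct pairs of \<open>G\<close>, which preserves their
  independence.\<close>

lemma inj_image_old_label: "inj_on ((`) (old_label r G)) (pairs (fst G - num_core_nbrs r G))"
  using inj_on_image_Pow[OF inj_old_label] pairs_subset_Pow by (rule inj_on_subset)

text \<open>\<open>Stack r\<close> is the old label of no vertex, so the pairs revealed by the
  exploration are never read again. A pair whose stack end is a former neighbour becomes a genuine
  core pair, because its other end is a non-neighbour.\<close>

lemma image_old_label_in:
  assumes "e \<in> pairs (fst G - num_core_nbrs r G)"
  shows "old_label r G ` e \<in> pairs (fst G) - star r {..<fst G}"
  using assms
proof (cases rule: pairs_cases)
  case (core i j)
  obtain a where a: "old_label r G (Core i) = Core a" "a < fst G"
    using core old_label_Core_in[of i G r] by auto
  obtain b where b: "old_label r G (Core j) = Core b" "b < fst G"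
    using core old_label_Core_in[of j G r] by auto
  have "old_label r G (Core i) \<noteq> old_label r G (Core j)"
    using core inj_onD[OF inj_old_label, of r G "Core i" "Core j"] by auto
  then have "a \<noteq> b" using a b by auto
  then show ?thesis unfolding core(1) image_insert image_empty a(1) b(1)
    by (auto simp: a b core_pair_in_pairs star_def doubleton_eq_iff)
next
  case (stack k i)
  obtain a where a: "old_label r G (Core i) = Core a" "a < fst G" "a \<notin> core_nbrs r G"
    using stack old_label_Core_in[of i G r] by auto
  show ?thesis
  proof (cases rule: old_label_Stack_cases[of r G k])
    case (core b)
    moreover have "b < fst G" using core core_nbrs_subset by blast
    moreover have "a \<noteq> b" using a core by auto
    ultimately show ?thesis unfolding stack(1) image_insert image_empty a(1) core(1)
      by (auto simp: a core_pair_in_pairs star_def doubleton_eq_iff)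
  next
    case (stack b)
    then show ?thesis unfolding \<open>e = _\<close> image_insert image_empty a(1) stack(1)
      by (auto simp: a stack_core_pair_in_pairs star_def doubleton_eq_iff)
  qed
qed

text \<open>
  The relabelling depends on the graph only through the core size and the neighbours of \<open>\<rho>\<close>, so it
  can be computed in the graph whose only edges are those from \<open>\<rho>\<close> to \<open>S\<close>.
\<close>
definition label :: "nat \<Rightarrow> nat \<Rightarrow> nat set \<Rightarrow> vertex \<Rightarrow> vertex" where
  "label r n S = old_label r (n, star r S)"

lemma core_nbrs_star: "S \<subseteq> {..<n} \<Longrightarrow> core_nbrs r (n, star r S) = S"
  by (auto simp: core_nbrs_def star_def doubleton_eq_iff)

lemma old_label_eq_label: "old_label r G = label r (fst G) (core_nbrs r G)"
proof
  show "old_label r G u = label r (fst G) (core_nbrs r G) u" for u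
    by (cases u)
       (simp_all add: label_def core_nbrs_star[OF core_nbrs_subset] num_core_nbrs_def Let_def)
qed

subsection \<open>Measurability\<close>

lemma space_edge_space [simp]: "space edge_space = UNIV"
  by (simp add: edge_space_def space_measure_of_conv)

lemma space_graph_space [simp]: "space graph_space = UNIV"
  by (simp add: graph_space_def space_pair_measure)

lemma sets_edge_space: "sets edge_space = sigma_sets UNIV {{E. {u, v} \<in> E} |u v. True}"
  by (simp add: edge_space_def)

lemma pred_edge: "Measurable.pred edge_space (\<lambda>E. {u, v} \<in> E)"
  unfolding pred_def sets_edge_space by (rule sigma_sets.Basic) auto

lemma measurable_edge_spaceI:
  assumes "\<And>u v. Measurable.pred M (\<lambda>x. {u, v} \<in> f x)"
  shows "f \<in> measurable M edge_space"
  unfolding edge_space_def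
proof (rule measurable_measure_of)
  fix y :: "vertex set set set" assume "y \<in> {{E. {u, v} \<in> E} |u v. True}"
  then obtain u v where "y = {E. {u, v} \<in> E}" by auto
  then show "f -` y \<inter> space M \<in> sets M"
    using assms[of u v] by (simp add: pred_def Int_def vimage_def conj_commute)
qed auto

lemma measurable_fst_graph [measurable]: "fst \<in> measurable graph_space (count_space UNIV)"
  unfolding graph_space_def by measurable

lemma pred_snd_graph [measurable]: "Measurable.pred graph_space (\<lambda>G. {u, v} \<in> snd G)"
  unfolding graph_space_def by (rule measurable_compose[OF measurable_snd pred_edge])

text \<open>The target consists of the finite sets because these are countably many, so only
  preimages of singletons have to be checked; each is a countable conjunction of conditions on the
  core size and on single edges.\<close>

lemma measurable_core_nbrs [measurable]:
  "core_nbrs r \<in> measurable graph_space (count_space (Collect finite))"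
proof (subst measurable_count_space_eq_countable)
  show "countable (Collect finite :: nat set set)"
    using countable_Collect_finite[where 'a=nat] by simp
  have "Measurable.pred graph_space (\<lambda>G. core_nbrs r G = S)" for S
  proof -
    have "core_nbrs r G = S \<longleftrightarrow> (\<forall>i. (i < fst G \<and> {Stack r, Core i} \<in> snd G) \<longleftrightarrow> i \<in> S)" for G
      by (auto simp: core_nbrs_def)
    then show ?thesis by simp
  qed
  then show "core_nbrs r \<in> space graph_space \<rightarrow> Collect finite \<and>
      (\<forall>S\<in>Collect finite. core_nbrs r -` {S} \<inter> space graph_space \<in> sets graph_space)"
    by (auto simp: finite_core_nbrs pred_def vimage_def)
qed

lemma measurable_num_core_nbrs [measurable]:
  "num_core_nbrs r \<in> measurable graph_space (count_space UNIV)"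
  unfolding num_core_nbrs_def by measurable

text \<open>The relabelling is random, but the pair (core size, neighbour set) that determines it
  has countably many values. With this pair frozen, each potential new edge is either constantly
  absent or one fixed edge of the old graph; \<open>measurable_compose_countable'\<close> glues
  these maps.\<close>

lemma measurable_explore [measurable]: "explore r \<in> measurable graph_space graph_space"
proof -
  define f :: "nat \<times> nat set \<Rightarrow> graph \<Rightarrow> graph" where "f = (\<lambda>(n, S) G.
    (n - card S, {e \<in> pairs (n - card S). label r n S ` e \<in> snd G}))"
  have f: "f i \<in> measurable graph_space graph_space" for i
    unfolding f_def split_def
    by (subst (2) graph_space_def, intro measurable_Pair measurable_edge_spaceI) simp_all
  have "(\<lambda>G. f (fst G, core_nbrs r G) G) \<in> measurable graph_space graph_space"
  proof (rule measurable_compose_countable'[OF f])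
    show "countable (UNIV \<times> Collect finite :: (nat \<times> nat set) set)"
      using countable_Collect_finite[where 'a=nat] by simp
    have "(\<lambda>G. (fst G, core_nbrs r G))
       \<in> measurable graph_space (count_space UNIV \<Otimes>\<^sub>M count_space (Collect finite))"
      by measurable
    then show "(\<lambda>G. (fst G, core_nbrs r G))
       \<in> measurable graph_space (count_space (UNIV \<times> Collect finite))"
      using countable_Collect_finite[where 'a=nat]
      by (simp add: pair_measure_countable)
  qed
  also have "(\<lambda>G. f (fst G, core_nbrs r G) G) = explore r"
    by (auto simp: f_def explore_eq old_label_eq_label num_core_nbrs_def)
  finally show ?thesis .
qed

subsection \<open>Cylinders\<close>

text \<open>Only presence of edges is prescribed, so that intersecting cylinders of equal core size
  amounts to uniting their sets \<open>J\<close>.\<close>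

definition cylinder :: "nat \<Rightarrow> vertex set set \<Rightarrow> graph set" where
  "cylinder m J = {G. fst G = m \<and> J \<subseteq> snd G}"

text \<open>Loops \<open>{u, u}\<close> are included to match the generators of
  \<open>edge_space\<close>.\<close>

definition upairs :: "vertex set set" where
  "upairs = {{u, v} |u v. True}"

text \<open>The empty set is added because cylinders with different core sizes are disjoint.\<close>

definition cylinders :: "graph set set" where
  "cylinders = insert {} {cylinder m J |m J. finite J \<and> J \<subseteq> upairs}"

lemma pairs_subset_upairs: "pairs n \<subseteq> upairs"
  by (auto simp: pairs_def core_pairs_def stack_core_pairs_def upairs_def)

lemma Int_stable_cylinders: "Int_stable cylinders"
proof (rule Int_stableI)
  fix a b assume ab: "a \<in> cylinders" "b \<in> cylinders"
  show "a \<inter> b \<in> cylinders"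
  proof (cases "a \<inter> b = {}")
    case False
    then obtain m J m' J' where J: "a = cylinder m J" "b = cylinder m' J'"
        "finite (J \<union> J')" "J \<union> J' \<subseteq> upairs"
      using ab by (auto simp: cylinders_def)
    then have "a \<inter> b = cylinder m (J \<union> J')"
      using False by (auto simp: cylinder_def)
    then show ?thesis unfolding cylinders_def using J(3,4) by blast
  qed (simp add: cylinders_def)
qed

lemma sets_edge_space_cylinders:
  "sets edge_space = sigma_sets UNIV {{E. J \<subseteq> E} |J. finite J \<and> J \<subseteq> upairs}"
  unfolding sets_edge_space
proof (rule sigma_sets_eqI)
  fix a :: "vertex set set set" assume "a \<in> {{E. {u, v} \<in> E} |u v. True}"
  then obtain u v where a: "a = {E. {{u, v}} \<subseteq> E}" by auto
  have "{{u, v}} \<subseteq> upairs" by (auto simp: upairs_def)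
  then have "a \<in> {{E. J \<subseteq> E} |J. finite J \<and> J \<subseteq> upairs}"
    unfolding a by blast
  then show "a \<in> sigma_sets UNIV {{E. J \<subseteq> E} |J. finite J \<and> J \<subseteq> upairs}"
    by (rule sigma_sets.Basic)
next
  fix b :: "vertex set set set" assume "b \<in> {{E. J \<subseteq> E} |J. finite J \<and> J \<subseteq> upairs}"
  then obtain J where J: "b = {E. J \<subseteq> E}" "finite J" "J \<subseteq> upairs" by auto
  have "{E. J \<subseteq> E} \<in> sets edge_space"
    using J(2,3)
  proof (induction J)
    case empty
    then show ?case using sets.top[of edge_space] by simp
  next
    case (insert e J)
    have "{E. e \<in> E} \<in> sets edge_space"
      using insert.prems pred_edge by (auto simp: pred_def upairs_def)
    moreover have "{E. insert e J \<subseteq> E} = {E. e \<in> E} \<inter> {E. J \<subseteq> E}" by auto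
    ultimately show ?case using insert by auto
  qed
  then show "b \<in> sigma_sets UNIV {{E. {u, v} \<in> E} |u v. True}"
    by (simp add: J(1) sets_edge_space)
qed

text \<open>A cylinder is a rectangle with a singleton as first side and an inclusion event as
  second; both kinds of sides generate their factor.\<close>

lemma sets_graph_space: "sets graph_space = sigma_sets UNIV cylinders"
proof -
  let ?A = "range (\<lambda>m::nat. {m})" and ?B = "{{E. J \<subseteq> E} |J. finite J \<and> J \<subseteq> upairs}"
  let ?R = "{a \<times> b |a b. a \<in> ?A \<and> b \<in> ?B}"
  have A: "sets (count_space (UNIV::nat set)) = sets (sigma UNIV ?A)"
  proof -
    have "X \<in> sigma_sets UNIV ?A" for X :: "nat set"
    proof -
      have "\<Union>((\<lambda>m. {m}) ` X) \<in> sigma_sets UNIV ?A"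
        by (rule sigma_sets_UNION) (auto intro: sigma_sets.Basic)
      then show ?thesis by simp
    qed
    then show ?thesis by (simp add: UNIV_eq_I)
  qed
  have B: "sets edge_space = sets (sigma UNIV ?B)"
    by (simp add: sets_edge_space_cylinders)
  have "sets graph_space = sets (sigma UNIV ?A \<Otimes>\<^sub>M sigma UNIV ?B)"
    unfolding graph_space_def by (rule sets_pair_measure_cong[OF A B])
  also have "sigma UNIV ?A \<Otimes>\<^sub>M sigma UNIV ?B = sigma (UNIV \<times> UNIV) ?R"
  proof (rule sigma_prod)
    show "\<exists>E\<subseteq>?A. countable E \<and> UNIV = \<Union>E" by (intro exI[of _ ?A]) simp
    \<comment> \<open>\<open>sigma_prod\<close> asks for a countable cover from each generator: the
      singletons on the first factor, and here the single event given by
      \<open>J = {}\<close>.\<close>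
    have "UNIV \<in> ?B" by (rule CollectI, rule exI[of _ "{}"]) simp
    then show "\<exists>E\<subseteq>?B. countable E \<and> UNIV = \<Union>E"
      by (intro exI[of _ "{UNIV}"]) simp
  qed simp_all
  also have "?R = {cylinder m J |m J. finite J \<and> J \<subseteq> upairs}" (is "_ = ?C")
  proof -
    have *: "cylinder m J = {m} \<times> {E. J \<subseteq> E}" for m J by (auto simp: cylinder_def)
    show ?thesis unfolding * by blast
  qed
  also have "sets (sigma (UNIV \<times> UNIV) ?C) = sigma_sets UNIV ?C" by simp
  also have "\<dots> = sigma_sets UNIV cylinders"
    unfolding cylinders_def
    by (rule sigma_sets_eqI) (auto intro: sigma_sets.Empty sigma_sets.Basic)
  finally show ?thesis .
qed

subsection \<open>Probabilities of cylinders\<close>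

lemma retained_measurable:
  "(\<lambda>\<omega>. {e \<in> A. \<omega> e}) \<in> measurable (Pi\<^sub>M A (\<lambda>_. measure_pmf (bernoulli_pmf p))) edge_space"
proof (rule measurable_edge_spaceI)
  fix u v
  show "Measurable.pred (Pi\<^sub>M A (\<lambda>_. measure_pmf (bernoulli_pmf p))) (\<lambda>\<omega>. {u, v} \<in> {e \<in> A. \<omega> e})"
  proof (cases "{u, v} \<in> A")
    case True
    then have "(\<lambda>\<omega>. \<omega> {u, v})
        \<in> measurable (Pi\<^sub>M A (\<lambda>_. measure_pmf (bernoulli_pmf p))) (measure_pmf (bernoulli_pmf p))"
      by (rule measurable_component_singleton)
    then show ?thesis using True by simp
  qed simp
qed

lemma product_bernoulli: "product_prob_space (\<lambda>_. measure_pmf (bernoulli_pmf p))"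
  by (rule product_prob_spaceI) (rule prob_space_measure_pmf)

lemma sets_random_edges [simp]: "sets (random_edges p A) = sets edge_space"
  by (simp add: random_edges_def)

lemma prob_space_random_edges: "prob_space (random_edges p A)"
proof -
  interpret product_prob_space "\<lambda>_. measure_pmf (bernoulli_pmf p)" A
    by (rule product_bernoulli)
  show ?thesis
    unfolding random_edges_def by (rule prob_space_distr) (rule retained_measurable)
qed

lemma Pair_measurable_graph_space: "Pair n \<in> measurable edge_space graph_space"
  unfolding graph_space_def by simp

lemma Pair_measurable_random_edges: "Pair n \<in> measurable (random_edges p A) graph_space"
  using Pair_measurable_graph_space by (simp cong: measurable_cong_sets)

lemma sets_G_given_core [simp]: "sets (G_given_core n p) = sets graph_space"
  by (simp add: G_given_core_def)

lemma prob_space_G_given_core: "prob_space (G_given_core n p)"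
  unfolding G_given_core_def
  by (intro prob_space.prob_space_distr prob_space_random_edges Pair_measurable_random_edges)

lemma G_given_core_measurable:
  "(\<lambda>n. G_given_core n p) \<in> measurable (measure_pmf D) (subprob_algebra graph_space)"
  by (auto simp: space_subprob_algebra prob_space_G_given_core prob_space_imp_subprob_space)

lemma sets_G_Poi [simp]: "sets (G_Poi \<alpha> p) = sets graph_space"
  unfolding G_Poi_def by (rule sets_bind) auto

lemma space_G_Poi [simp]: "space (G_Poi \<alpha> p) = UNIV"
  using sets_eq_imp_space_eq[OF sets_G_Poi] by simp

lemma emeasure_G_Poi:
  "X \<in> sets graph_space \<Longrightarrow>
   emeasure (G_Poi \<alpha> p) X = (\<integral>\<^sup>+n. emeasure (G_given_core n p) X \<partial>measure_pmf (poisson_law \<alpha>))"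
  unfolding G_Poi_def by (rule emeasure_bind[OF _ G_given_core_measurable]) simp_all

lemma prob_space_G_Poi: "prob_space (G_Poi \<alpha> p)"
  unfolding G_Poi_def
  by (rule measure_pmf.prob_space_bind[OF _ G_given_core_measurable])
     (simp add: prob_space_G_given_core)

section \<open>Probability of a finite edge configuration\<close>

text \<open>The index set \<open>A\<close> may be infinite, as \<open>pairs n\<close> is for
  \<open>n > 0\<close>; the event constrains finitely many coordinates, so its probability is a
  finite product.\<close>

lemma emeasure_PiM_bernoulli:
  assumes p: "0 \<le> p" "p \<le> 1"
    and fin: "finite T" "finite F" and disj: "T \<inter> F = {}" and sub: "T \<union> F \<subseteq> A"
  shows "emeasure (Pi\<^sub>M A (\<lambda>_. measure_pmf (bernoulli_pmf p)))
       {\<omega> \<in> space (Pi\<^sub>M A (\<lambda>_. measure_pmf (bernoulli_pmf p))). (\<forall>e\<in>T. \<omega> e) \<and> (\<forall>e\<in>F. \<not> \<omega> e)}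
     = ennreal (p ^ card T * (1 - p) ^ card F)" (is "emeasure ?P ?X = _")
proof -
  interpret product_prob_space "\<lambda>_. measure_pmf (bernoulli_pmf p)" A
    by (rule product_bernoulli)
  \<comment> \<open>\<open>{e \<in> T}\<close> is the singleton of a truth value:
    \<open>{True}\<close> on \<open>T\<close> and \<open>{False}\<close> on
    \<open>F\<close>.\<close>
  have "?X = {\<omega> \<in> space ?P. \<forall>e\<in>T \<union> F. \<omega> e \<in> {e \<in> T}}"
    using disj by auto
  also have "emeasure ?P \<dots> = (\<Prod>e\<in>T \<union> F. emeasure (measure_pmf (bernoulli_pmf p)) {e \<in> T})"
    using fin sub by (intro emeasure_PiM_Collect) auto
  also have "\<dots> = (\<Prod>e\<in>T. ennreal p) * (\<Prod>e\<in>F. ennreal (1 - p))"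
  proof -
    have "(\<Prod>e\<in>F. emeasure (measure_pmf (bernoulli_pmf p)) {e \<in> T}) = (\<Prod>e\<in>F. ennreal (1 - p))"
    proof (rule prod.cong)
      fix e assume "e \<in> F"
      then have "e \<notin> T" using disj by auto
      then show "emeasure (measure_pmf (bernoulli_pmf p)) {e \<in> T} = ennreal (1 - p)"
        using p by (simp add: emeasure_pmf_single)
    qed simp
    then show ?thesis
      using p fin disj by (simp add: prod.union_disjoint emeasure_pmf_single)
  qed
  also have "\<dots> = ennreal (p ^ card T * (1 - p) ^ card F)"
    using p by (simp add: ennreal_power ennreal_mult)
  finally show ?thesis .
qed

lemma emeasure_G_given_core:
  assumes "X \<in> sets graph_space"
  shows "emeasure (G_given_core n p) X =
    emeasure (Pi\<^sub>M (pairs n) (\<lambda>_. measure_pmf (bernoulli_pmf p)))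
      {\<omega> \<in> space (Pi\<^sub>M (pairs n) (\<lambda>_. measure_pmf (bernoulli_pmf p))). (n, {e \<in> pairs n. \<omega> e}) \<in> X}"
proof -
  have "emeasure (G_given_core n p) X = emeasure (random_edges p (pairs n)) (Pair n -` X)"
    unfolding G_given_core_def pairs_def[symmetric]
    using assms Pair_measurable_random_edges
    by (subst emeasure_distr)
       (auto simp: sets_eq_imp_space_eq[OF sets_random_edges])
  also have "\<dots> = emeasure (Pi\<^sub>M (pairs n) (\<lambda>_. measure_pmf (bernoulli_pmf p)))
      ((\<lambda>\<omega>. {e \<in> pairs n. \<omega> e}) -` (Pair n -` X)
        \<inter> space (Pi\<^sub>M (pairs n) (\<lambda>_. measure_pmf (bernoulli_pmf p))))"
    unfolding random_edges_def
    using measurable_sets[OF Pair_measurable_graph_space assms]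
    by (intro emeasure_distr retained_measurable) simp
  finally show ?thesis by (simp add: vimage_def Int_def conj_commute)
qed

lemma emeasure_G_given_core_eq_0:
  assumes "X \<in> sets graph_space" and "\<And>E. E \<subseteq> pairs n \<Longrightarrow> (n, E) \<notin> X"
  shows "emeasure (G_given_core n p) X = 0"
proof -
  have "(n, {e \<in> pairs n. \<omega> e}) \<notin> X" for \<omega> using assms(2) by auto
  then show ?thesis using assms(1) by (simp add: emeasure_G_given_core)
qed

text \<open>The event is compared with the edge conditions only for
  \<open>E \<subseteq> pairs n\<close>, since the retained edges always form such a set.\<close>

lemma emeasure_G_given_core_edges:
  assumes "0 \<le> p" "p \<le> 1" and X: "X \<in> sets graph_space"
    and "finite T" "finite F" "T \<inter> F = {}" "T \<union> F \<subseteq> pairs n"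
    and eq: "\<And>E. E \<subseteq> pairs n \<Longrightarrow> (n, E) \<in> X \<longleftrightarrow> T \<subseteq> E \<and> F \<inter> E = {}"
  shows "emeasure (G_given_core n p) X = ennreal (p ^ card T * (1 - p) ^ card F)"
proof -
  have *: "(n, {e \<in> pairs n. \<omega> e}) \<in> X \<longleftrightarrow> (\<forall>e\<in>T. \<omega> e) \<and> (\<forall>e\<in>F. \<not> \<omega> e)" for \<omega>
    using assms(7) by (subst eq) auto
  show ?thesis
    unfolding emeasure_G_given_core[OF X] * using assms(1,2,4-7) by (rule emeasure_PiM_bernoulli)
qed

lemma cylinder_sets: "finite J \<Longrightarrow> J \<subseteq> upairs \<Longrightarrow> cylinder m J \<in> sets graph_space"
  unfolding sets_graph_space by (rule sigma_sets.Basic) (auto simp: cylinders_def)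

text \<open>A pair of \<open>J\<close> outside \<open>pairs m\<close> can never be an edge, whence
  the value 0. The factor \<open>indicator {m} n\<close> lets the later integral over
  \<open>n\<close> collapse to one term.\<close>

lemma emeasure_G_given_core_cylinder:
  assumes p: "0 \<le> p" "p \<le> 1" and J: "finite J" "J \<subseteq> upairs"
  shows "emeasure (G_given_core n p) (cylinder m J)
    = ennreal (if J \<subseteq> pairs m then p ^ card J else 0) * indicator {m} n"
proof (cases "n = m \<and> J \<subseteq> pairs m")
  case True
  then have "emeasure (G_given_core n p) (cylinder m J)
      = ennreal (p ^ card J * (1 - p) ^ card ({} :: vertex set set))"
    using J by (intro emeasure_G_given_core_edges p cylinder_sets) (auto simp: cylinder_def)
  then show ?thesis using True by simp
next
  case False
  then have "emeasure (G_given_core n p) (cylinder m J) = 0"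
    using J by (intro emeasure_G_given_core_eq_0 cylinder_sets) (auto simp: cylinder_def)
  then show ?thesis using False by (auto split: split_indicator)
qed

section \<open>Law of the explored graph given the core size\<close>

lemma core_nbrs_eq_iff:
  assumes "S \<subseteq> {..<n}"
  shows "core_nbrs r (n, E) = S \<longleftrightarrow> star r S \<subseteq> E \<and> star r ({..<n} - S) \<inter> E = {}"
proof
  show "core_nbrs r (n, E) = S" if "star r S \<subseteq> E \<and> star r ({..<n} - S) \<inter> E = {}"
    using that assms unfolding core_nbrs_def star_def by auto blast
qed (use assms in \<open>auto simp: core_nbrs_def star_def\<close>)

lemma core_nbrs_explore_sets:
  "X \<in> sets graph_space \<Longrightarrow>
   {G. core_nbrs r G = S \<and> explore r G \<in> X} \<in> sets graph_space"
proof -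
  assume X: "X \<in> sets graph_space"
  have "core_nbrs r -` {S} \<inter> space graph_space \<in> sets graph_space" if "finite S"
    using that by (intro measurable_sets[OF measurable_core_nbrs]) simp
  then have "core_nbrs r -` {S} \<in> sets graph_space"
  proof (cases "finite S")
    \<comment> \<open>Neighbour sets are finite, so an infinite \<open>S\<close> has empty
      preimage.\<close>
    case False
    then have "core_nbrs r -` {S} = {}" using finite_core_nbrs by auto
    then show ?thesis by simp
  qed simp
  moreover have "explore r -` X \<in> sets graph_space"
    using measurable_sets[OF measurable_explore X] by simp
  ultimately have "core_nbrs r -` {S} \<inter> explore r -` X \<in> sets graph_space" by (rule sets.Int)
  then show ?thesis by (simp add: vimage_def Int_def)
qed

lemma num_core_nbrs_explore_sets:
  assumes "X \<in> sets graph_space"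
  shows "{G. num_core_nbrs r G = k \<and> explore r G \<in> X} \<in> sets graph_space"
proof -
  have "num_core_nbrs r -` {k} \<in> sets graph_space"
    using measurable_sets[OF measurable_num_core_nbrs, of "{k}"] by simp
  moreover have "explore r -` X \<in> sets graph_space"
    using measurable_sets[OF measurable_explore assms] by simp
  ultimately have "num_core_nbrs r -` {k} \<inter> explore r -` X \<in> sets graph_space" by (rule sets.Int)
  then show ?thesis by (simp add: vimage_def Int_def)
qed

text \<open>The event prescribes disjoint sets of pairs: \<open>k\<close> present and
  \<open>m\<close> absent at \<open>Stack r\<close>, and \<open>card J\<close> present
  elsewhere.\<close>

lemma emeasure_core_nbrs_explore_cylinder:
  assumes p: "0 \<le> p" "p \<le> 1" and J: "finite J" "J \<subseteq> pairs m"
    and S: "S \<subseteq> {..<m + k}" "card S = k"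
  shows "emeasure (G_given_core (m + k) p) {G. core_nbrs r G = S \<and> explore r G \<in> cylinder m J}
    = ennreal (p ^ k * (1 - p) ^ m * p ^ card J)"
proof -
  define n where "n = m + k"
  define L where "L = label r n S"
  \<comment> \<open>\<open>T\<close> collects the pairs forced to be edges, \<open>F\<close> those
    forced to be absent.\<close>
  define T where "T = star r S \<union> (`) L ` J"
  define F where "F = star r ({..<n} - S)"
  have nk: "n - k = m" by (simp add: n_def)
  have finS: "finite S" using S(1) by (rule finite_subset) simp
  have S': "S \<subseteq> {..<n}" using S by (simp add: n_def)
  have G0: "core_nbrs r (n, star r S) = S" "num_core_nbrs r (n, star r S) = k"
    using S' S(2) by (simp_all add: core_nbrs_star num_core_nbrs_def)
  \<comment> \<open>Distinct pairs of \<open>J\<close> give distinct conditions, hence exactly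
    \<open>card J\<close> factors \<open>p\<close>.\<close>
  have "inj_on ((`) L) (pairs m)"
    using inj_image_old_label[of r "(n, star r S)"] nk by (simp add: G0 L_def label_def)
  then have "inj_on ((`) L) J" using J(2) by (rule inj_on_subset)
  then have cardJ: "card ((`) L ` J) = card J" by (rule card_image)
  have "(`) L ` pairs m \<subseteq> pairs n - star r {..<n}"
    using image_old_label_in[of _ "(n, star r S)" r]
    by (auto simp: G0 nk L_def label_def)
  then have LJ: "(`) L ` J \<subseteq> pairs n - star r {..<n}" using J(2) by blast
  have star_mono: "star r S \<subseteq> star r {..<n}" "star r ({..<n} - S) \<subseteq> star r {..<n}"
    using S' by (auto simp: star_def)
  have star_disj: "star r S \<inter> star r ({..<n} - S) = {}"
    by (auto simp: star_def doubleton_eq_iff)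
  have card_star: "card (star r B) = card B" for B
    unfolding star_def by (rule card_image[OF inj_star])
  have finite_star: "finite (star r B)" if "finite B" for B
    using that by (simp add: star_def)
  have "emeasure (G_given_core n p) {G. core_nbrs r G = S \<and> explore r G \<in> cylinder m J}
      = ennreal (p ^ card T * (1 - p) ^ card F)"
  proof (rule emeasure_G_given_core_edges[OF p])
    show "{G. core_nbrs r G = S \<and> explore r G \<in> cylinder m J} \<in> sets graph_space"
      using J pairs_subset_upairs by (intro core_nbrs_explore_sets cylinder_sets) auto
    show "finite T" "finite F" using J(1) finS by (simp_all add: T_def F_def finite_star)
    show "T \<inter> F = {}" unfolding T_def F_def using LJ star_mono star_disj by blast
    show "T \<union> F \<subseteq> pairs n"
      using LJ S' star_subset_pairs[of _ n] by (auto simp: T_def F_def)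
    fix E assume "E \<subseteq> pairs n"
    \<comment> \<open>Once the neighbour set is \<open>S\<close>, the relabelling is the
      deterministic map \<open>L\<close>.\<close>
    have "explore r (n, E) \<in> cylinder m J \<longleftrightarrow> (`) L ` J \<subseteq> E" if *: "core_nbrs r (n, E) = S"
    proof -
      have "explore r (n, E) = (m, {e \<in> pairs m. L ` e \<in> E})"
        using S(2) by (simp add: explore_eq old_label_eq_label num_core_nbrs_def * nk L_def)
      then show ?thesis using J(2) by (auto simp: cylinder_def)
    qed
    then show "(n, E) \<in> {G. core_nbrs r G = S \<and> explore r G \<in> cylinder m J}
        \<longleftrightarrow> T \<subseteq> E \<and> F \<inter> E = {}"
      using core_nbrs_eq_iff[OF S', of r E] by (auto simp: T_def F_def)
  qed
  moreover have "card T = k + card J"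
  proof -
    have "star r S \<inter> (`) L ` J = {}" using LJ star_mono by blast
    then show ?thesis
      unfolding T_def using J(1) finS finite_star
      by (simp add: card_Un_disjoint cardJ card_star S(2))
  qed
  moreover have "card F = m"
    using S finS by (simp add: F_def card_star card_Diff_subset n_def)
  ultimately show ?thesis by (simp add: n_def power_add mult_ac)
qed

text \<open>The event splits disjointly according to the neighbour set; each of the
  \<open>(m + k) choose k\<close> candidates has the same probability.\<close>

lemma emeasure_explore_cylinder:
  assumes p: "0 \<le> p" "p \<le> 1" and J: "finite J" "J \<subseteq> upairs"
  shows "emeasure (G_given_core n p) {G. num_core_nbrs r G = k \<and> explore r G \<in> cylinder m J}
    = ennreal (real ((m + k) choose k) * p ^ k * (1 - p) ^ m * (if J \<subseteq> pairs m then p ^ card J else 0))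
      * indicator {m + k} n"
proof (cases "n = m + k \<and> J \<subseteq> pairs m")
  case True
  let ?I = "{S. S \<subseteq> {..<m + k} \<and> card S = k}"
  let ?F = "\<lambda>S. {G. core_nbrs r G = S \<and> explore r G \<in> cylinder m J}"
  let ?X = "{G. num_core_nbrs r G = k \<and> explore r G \<in> cylinder m J}"
  have n: "n = m + k" and Jm: "J \<subseteq> pairs m" using True by auto
  have "emeasure (G_given_core n p) ?X = emeasure (G_given_core n p) (\<Union>S\<in>?I. ?F S)"
  proof -
    have "{\<omega> \<in> W. (n, {e \<in> pairs n. \<omega> e}) \<in> ?X} = {\<omega> \<in> W. (n, {e \<in> pairs n. \<omega> e}) \<in> (\<Union>S\<in>?I. ?F S)}" for W
      using core_nbrs_subset[of r "(n, _)"] by (auto simp: num_core_nbrs_def n)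
    moreover have "(\<Union>S\<in>?I. ?F S) \<in> sets graph_space"
      using J by (intro sets.finite_UN core_nbrs_explore_sets cylinder_sets) auto
    ultimately show ?thesis
      using J by (simp add: emeasure_G_given_core num_core_nbrs_explore_sets cylinder_sets)
  qed
  also have "\<dots> = (\<Sum>S\<in>?I. emeasure (G_given_core n p) (?F S))"
  proof (rule sum_emeasure[symmetric])
    show "?F ` ?I \<subseteq> sets (G_given_core n p)"
      using J by (auto intro!: core_nbrs_explore_sets cylinder_sets)
  qed (auto simp: disjoint_family_on_def)
  also have "\<dots> = (\<Sum>S\<in>?I. ennreal (p ^ k * (1 - p) ^ m * p ^ card J))"
    using p J(1) Jm by (intro sum.cong refl) (simp add: n emeasure_core_nbrs_explore_cylinder)
  also have "\<dots> = ennreal (real ((m + k) choose k) * p ^ k * (1 - p) ^ m * p ^ card J)"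
    using p by (simp add: n_subsets ennreal_of_nat_eq_real_of_nat ennreal_mult[symmetric] mult_ac)
  finally show ?thesis using Jm by (simp add: n)
next
  case False
  \<comment> \<open>Subtraction on naturals truncates; this bound is what turns
    \<open>n - k = m\<close> into \<open>n = m + k\<close>.\<close>
  have "num_core_nbrs r (n, E) \<le> n" for E
    using card_mono[OF _ core_nbrs_subset[of r "(n, E)"]] by (simp add: num_core_nbrs_def)
  then have "emeasure (G_given_core n p) {G. num_core_nbrs r G = k \<and> explore r G \<in> cylinder m J} = 0"
    using J False
    by (intro emeasure_G_given_core_eq_0 num_core_nbrs_explore_sets cylinder_sets)
       (auto simp: cylinder_def explore_eq)
  then show ?thesis using False by (auto split: split_indicator)
qed

section \<open>Poisson thinning and independence\<close>

text \<open>The convention \<open>0 ^ 0 = 1\<close> makes the formula cover the Dirac mass at 0,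
  which occurs as a thinned law when \<open>p\<close> is 0 or 1.\<close>

lemma pmf_poisson_law: "0 \<le> \<alpha> \<Longrightarrow> pmf (poisson_law \<alpha>) n = \<alpha> ^ n / fact n * exp (- \<alpha>)"
  by (cases "n = 0") (auto simp: poisson_law_def)

text \<open>The binomial coefficient trades \<open>fact (m + k)\<close> for
  \<open>fact k * fact m\<close>, and the exponential splits along
  \<open>\<alpha> = \<alpha> * p + \<alpha> * (1 - p)\<close>.\<close>

lemma poisson_thinning:
  assumes "0 \<le> \<alpha>" "0 \<le> p" "p \<le> 1"
  shows "pmf (poisson_law \<alpha>) (m + k) * (real ((m + k) choose k) * p ^ k * (1 - p) ^ m)
    = pmf (poisson_law (\<alpha> * p)) k * pmf (poisson_law (\<alpha> * (1 - p))) m"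
proof -
  have "exp (- \<alpha>) = exp (- (\<alpha> * p)) * exp (- (\<alpha> * (1 - p)))"
    by (simp add: exp_add[symmetric] algebra_simps)
  moreover have "real ((m + k) choose k) = fact (m + k) / (fact k * fact m)"
    using binomial_fact[of k "m + k"] by simp
  ultimately show ?thesis
    using assms by (simp add: pmf_poisson_law power_mult_distrib power_add)
qed

text \<open>The product form expresses independence of \<open>K\<close> and the explored graph. For
  fixed \<open>k\<close> both sides are finite measures in \<open>X\<close>, so agreement on the
  intersection-stable generator \<open>cylinders\<close> suffices.\<close>

lemma emeasure_G_Poi_explore:
  assumes \<alpha>: "0 \<le> \<alpha>" and p: "0 \<le> p" "p \<le> 1" and X: "X \<in> sets graph_space"
  shows "emeasure (G_Poi \<alpha> p) {G. num_core_nbrs r G = k \<and> explore r G \<in> X}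
    = ennreal (pmf (poisson_law (\<alpha> * p)) k) * emeasure (G_Poi (\<alpha> * (1 - p)) p) X"
proof -
  let ?A = "{G. num_core_nbrs r G = k}"
  \<comment> \<open>Restricting to \<open>K = k\<close> by an indicator density and pushing forward
    along \<open>explore r\<close> makes the left side a measure in \<open>X\<close>.\<close>
  let ?M = "distr (density (G_Poi \<alpha> p) (indicator ?A)) graph_space (explore r)"
  let ?N = "scale_measure (ennreal (pmf (poisson_law (\<alpha> * p)) k)) (G_Poi (\<alpha> * (1 - p)) p)"
  have A: "?A \<in> sets graph_space"
    using measurable_sets[OF measurable_num_core_nbrs, of "{k}"] by (simp add: vimage_def)
  have M: "emeasure ?M Y = emeasure (G_Poi \<alpha> p) {G. num_core_nbrs r G = k \<and> explore r G \<in> Y}"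
    if Y: "Y \<in> sets graph_space" for Y
  proof -
    have "explore r -` Y \<in> sets graph_space"
      using measurable_sets[OF measurable_explore Y] by simp
    then have "emeasure ?M Y = emeasure (G_Poi \<alpha> p) (?A \<inter> explore r -` Y)"
      using A Y by (simp add: emeasure_distr emeasure_density
          indicator_inter_arith[symmetric] cong: measurable_cong_sets)
    then show ?thesis by (simp add: Int_def vimage_def)
  qed
  have cyl: "emeasure ?M (cylinder m J) = emeasure ?N (cylinder m J)"
    if J: "finite J" "J \<subseteq> upairs" for m J
  proof -
    \<comment> \<open>The probability of the edges \<open>J\<close> given core size
      \<open>m\<close>, a factor common to both sides.\<close>
    define q where "q = (if J \<subseteq> pairs m then p ^ card J else 0)"
    have q: "0 \<le> q" using p by (simp add: q_def)
    \<comment> \<open>The indicator leaves only the Poisson weight at \<open>m + k\<close>; for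
      \<open>?N\<close> it is the weight at \<open>m\<close>.\<close>
    have "emeasure ?M (cylinder m J)
        = ennreal (real ((m + k) choose k) * p ^ k * (1 - p) ^ m * q) * ennreal (pmf (poisson_law \<alpha>) (m + k))"
      using J p by (simp add: M cylinder_sets num_core_nbrs_explore_sets emeasure_G_Poi
          emeasure_explore_cylinder nn_integral_cmult_indicator emeasure_pmf_single q_def)
    also have "\<dots> = ennreal (pmf (poisson_law (\<alpha> * p)) k * pmf (poisson_law (\<alpha> * (1 - p))) m * q)"
      using p q by (simp add: ennreal_mult[symmetric] poisson_thinning[OF \<alpha> p, symmetric] mult_ac)
    also have "\<dots> = emeasure ?N (cylinder m J)"
      using J p q by (simp add: cylinder_sets emeasure_G_Poi emeasure_G_given_core_cylinder
          nn_integral_cmult_indicator emeasure_pmf_single q_def[symmetric] ennreal_mult[symmetric] mult_ac)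
    finally show ?thesis .
  qed
  have "?M = ?N"
  \<comment> \<open>The cylinders with \<open>J = {}\<close> split the space by core size and supply
    the countable cover by sets of finite measure.\<close>
  proof (rule measure_eqI_generator_eq[OF Int_stable_cylinders, where A="\<lambda>m. cylinder m {}" and \<Omega>=UNIV])
    show "emeasure ?M Y = emeasure ?N Y" if "Y \<in> cylinders" for Y
      using that cyl by (auto simp: cylinders_def)
    show "emeasure ?M (cylinder m {}) \<noteq> \<infinity>" for m
    proof -
      interpret prob_space "G_Poi \<alpha> p" by (rule prob_space_G_Poi)
      show ?thesis by (simp add: M cylinder_sets)
    qed
    show "(\<Union>m. cylinder m {}) = UNIV" by (auto simp: cylinder_def)
    show "range (\<lambda>m. cylinder m {}) \<subseteq> cylinders" unfolding cylinders_def by blast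
  qed (simp_all add: sets_graph_space)
  then have "emeasure ?M X = emeasure ?N X" by simp
  then show ?thesis using X by (simp add: M)
qed

section \<open>The law of \<open>K\<close> and the conditional law of the explored graph\<close>

theorem lemma1:
  fixes \<alpha> p :: real and r :: nat
  assumes "\<alpha> > 0" and "0 \<le> p" and "p \<le> 1"
  shows "distr (G_Poi \<alpha> p) (count_space UNIV) (num_core_nbrs r) = measure_pmf (poisson_law (\<alpha> * p))
    \<and> (\<forall>k. measure (G_Poi \<alpha> p) {G \<in> space (G_Poi \<alpha> p). num_core_nbrs r G = k} > 0 \<longrightarrow>
         distr (uniform_measure (G_Poi \<alpha> p) {G \<in> space (G_Poi \<alpha> p). num_core_nbrs r G = k})
           graph_space (explore r)
         = G_Poi (\<alpha> * (1 - p)) p)"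
proof (intro conjI allI impI)
  let ?A = "\<lambda>k. {G. num_core_nbrs r G = k}"
  have sets_A: "?A k \<in> sets graph_space" for k
    using measurable_sets[OF measurable_num_core_nbrs, of "{k}"] by (simp add: vimage_def)
  have explore: "emeasure (G_Poi \<alpha> p) {G. num_core_nbrs r G = k \<and> explore r G \<in> X}
      = ennreal (pmf (poisson_law (\<alpha> * p)) k) * emeasure (G_Poi (\<alpha> * (1 - p)) p) X"
    if "X \<in> sets graph_space" for X k
    using assms that by (intro emeasure_G_Poi_explore) auto
  \<comment> \<open>Taking \<open>X = UNIV\<close>, where the second factor has mass 1, isolates the
    marginal law of \<open>K\<close>.\<close>
  have K: "emeasure (G_Poi \<alpha> p) (?A k) = ennreal (pmf (poisson_law (\<alpha> * p)) k)" for k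
    using explore[of UNIV k] sets.top[of graph_space]
      prob_space.emeasure_space_1[OF prob_space_G_Poi, of "\<alpha> * (1 - p)" p] by simp
  show "distr (G_Poi \<alpha> p) (count_space UNIV) (num_core_nbrs r) = measure_pmf (poisson_law (\<alpha> * p))"
  proof (rule measure_eqI_countable[where A=UNIV])
    fix k :: nat
    have "emeasure (distr (G_Poi \<alpha> p) (count_space UNIV) (num_core_nbrs r)) {k}
        = emeasure (G_Poi \<alpha> p) (?A k)"
      using measurable_num_core_nbrs[of r]
      by (subst emeasure_distr) (simp_all add: vimage_def measurable_cong_sets[OF sets_G_Poi refl])
    then show "emeasure (distr (G_Poi \<alpha> p) (count_space UNIV) (num_core_nbrs r)) {k}
        = emeasure (measure_pmf (poisson_law (\<alpha> * p))) {k}"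
      by (simp add: K emeasure_pmf_single)
  qed simp_all
  fix k
  assume "measure (G_Poi \<alpha> p) {G \<in> space (G_Poi \<alpha> p). num_core_nbrs r G = k} > 0"
  \<comment> \<open>This Poisson weight is the divisor in the conditional measure; being positive
    and finite, it cancels.\<close>
  then have pos: "0 < pmf (poisson_law (\<alpha> * p)) k"
    by (simp add: measure_def K)
  have "distr (uniform_measure (G_Poi \<alpha> p) (?A k)) graph_space (explore r) = G_Poi (\<alpha> * (1 - p)) p"
  proof (rule measure_eqI)
    fix X assume "X \<in> sets (distr (uniform_measure (G_Poi \<alpha> p) (?A k)) graph_space (explore r))"
    then have X: "X \<in> sets graph_space" by simp
    have "explore r -` X \<in> sets graph_space"
      using measurable_sets[OF measurable_explore X] by simp
    then have "emeasure (distr (uniform_measure (G_Poi \<alpha> p) (?A k)) graph_space (explore r)) X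
        = emeasure (G_Poi \<alpha> p) (?A k \<inter> explore r -` X) / emeasure (G_Poi \<alpha> p) (?A k)"
      using X sets_A by (simp add: emeasure_distr cong: measurable_cong_sets)
    also have "?A k \<inter> explore r -` X = {G. num_core_nbrs r G = k \<and> explore r G \<in> X}" by auto
    also have "emeasure (G_Poi \<alpha> p) \<dots> / emeasure (G_Poi \<alpha> p) (?A k) = emeasure (G_Poi (\<alpha> * (1 - p)) p) X"
      unfolding explore[OF X] K mult.commute[of "ennreal _"]
      using pos by (intro mult_divide_eq_ennreal) simp_all
    finally show "emeasure (distr (uniform_measure (G_Poi \<alpha> p) (?A k)) graph_space (explore r)) X
        = emeasure (G_Poi (\<alpha> * (1 - p)) p) X" .
  qed simp
  then show "distr (uniform_measure (G_Poi \<alpha> p) {G \<in> space (G_Poi \<alpha> p). num_core_nbrs r G = k})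
      graph_space (explore r) = G_Poi (\<alpha> * (1 - p)) p"
    by simp
qed

end
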